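(* Let $n$ and $k$ be positive integers with $k>1$ and $n\geqslant k(k+1)$. Then the Roman domination number of the Kneser graph $K_{n,k}$ satisfies $\gamma_{R}(K_{n,k}) = 2(k+1)$.
   Context: For positive integers $n,k$, the Kneser graph $K_{n,k}$ is the simple graph whose vertices are all $k$-element subsets of $\{1,2,\dots,n\}$, two vertices being adjacent if and only if the corresponding sets are disjoint. Let $G=(V,E)$ be a finite simple graph. A Roman domination function (RDF) on $G$ is a function $f:V\to\{0,1,2\}$ such that every vertex $v$ with $f(v)=0$ has a neighbor $u$ with $f(u)=2$. The weight of $f$ is $f(V)=\sum_{v\in V}f(v)$. The Roman domination number $\gamma_{R}(G)$ is the minimum weight over all RDFs on $G$. *)

theory Defs
  imports "Graph_Theory.Pair_Digraph"
begin

text \<open>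
  Finite simple graphs are the \<open>pair_graph\<close>s of the Graph-Theory library: finite, loop-free,
  symmetric digraphs without parallel arcs, an edge being the two opposite arcs between its ends.
\<close>

definition kneser_graph :: "nat \<Rightarrow> nat \<Rightarrow> nat set pair_pre_digraph" where
  "kneser_graph n k =
     \<lparr> pverts = {A. A \<subseteq> {1..n} \<and> card A = k},
       parcs = {(A, B). A \<subseteq> {1..n} \<and> card A = k \<and> B \<subseteq> {1..n} \<and> card B = k \<and> A \<inter> B = {}} \<rparr>"

text \<open>
  Positivity of \<open>k\<close> is needed: for \<open>k = 0\<close> the empty set would carry a loop.
\<close>

lemma pair_graph_kneser_graph:
  assumes "k > 0"
  shows "pair_graph (kneser_graph n k)"
proof -
  let ?G = "kneser_graph n k"
  have "pverts ?G \<subseteq> Pow {1..n}" and "parcs ?G \<subseteq> Pow {1..n} \<times> Pow {1..n}"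
    by (auto simp: kneser_graph_def simp del: atLeastAtMost_iff)
  moreover have "finite (Pow {1..n})" "finite (Pow {1..n} \<times> Pow {1..n})"
    by simp_all
  ultimately have fin: "finite (pverts ?G)" "finite (parcs ?G)"
    by (blast intro: finite_subset)+
  have wf: "fst e \<in> pverts ?G" "snd e \<in> pverts ?G" if "e \<in> parcs ?G" for e
    using that by (auto simp: kneser_graph_def)
  have sym: "symmetric (with_proj ?G)"
    unfolding symmetric_def with_proj_simps by (rule symI) (simp add: kneser_graph_def Int_commute)
  have "A \<noteq> B" if "(A, B) \<in> parcs ?G" for A B
    using that assms unfolding kneser_graph_def by force
  then have noloop: "fst e \<noteq> snd e" if "e \<in> parcs ?G" for e
    using that by (metis prod.collapse)
  show ?thesis
    by unfold_locales (fact fin wf sym noloop)+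
qed

text \<open>
  HOL functions are total; only the values on the vertices of the graph matter below.
\<close>

definition roman_dominating :: "'a pair_pre_digraph \<Rightarrow> ('a \<Rightarrow> nat) \<Rightarrow> bool" where
  "roman_dominating G f \<longleftrightarrow>
     (\<forall>v \<in> pverts G. f v \<in> {0, 1, 2}) \<and>
     (\<forall>v \<in> pverts G. f v = 0 \<longrightarrow> (\<exists>u \<in> pverts G. (v, u) \<in> parcs G \<and> f u = 2))"

definition roman_weight :: "'a pair_pre_digraph \<Rightarrow> ('a \<Rightarrow> nat) \<Rightarrow> nat" where
  "roman_weight G f = (\<Sum>v \<in> pverts G. f v)"

definition roman_domination_number :: "'a pair_pre_digraph \<Rightarrow> nat" where
  "roman_domination_number G = (LEAST w. \<exists>f. roman_dominating G f \<and> roman_weight G f = w)"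

text \<open>
  The minimum is always attained, as the constant function \<open>1\<close> is Roman dominating.
\<close>

lemma roman_domination_number_attained:
  "\<exists>f. roman_dominating G f \<and> roman_weight G f = roman_domination_number G"
proof -
  have "roman_dominating G (\<lambda>_. 1)"
    by (simp add: roman_dominating_def)
  then show ?thesis
    unfolding roman_domination_number_def
    by (intro LeastI_ex[where P = "\<lambda>w. \<exists>f. roman_dominating G f \<and> roman_weight G f = w"]) blast
qed

lemma roman_domination_number_le:
  "roman_dominating G f \<Longrightarrow> roman_domination_number G \<le> roman_weight G f"
  unfolding roman_domination_number_def by (rule Least_le) blast

end

theory Submission
  imports Defs "HOL-Library.FuncSet" "HOL-Library.Disjoint_Sets"
begin

text \<open>
  Upper bound: a \<open>k\<close>-set cannot meet all of \<open>k + 1\<close> pairwise disjoint \<open>k\<close>-sets, so the value \<open>2\<close>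
  on such sets is Roman dominating. Lower bound: let \<open>F\<close> be the family of vertices of value \<open>2\<close>. A
  \<open>k\<close>-set meeting all members of \<open>F\<close> has no neighbour in \<open>F\<close>, hence has positive value, so the
  weight is at least \<open>card F\<close> plus the number of such transversals. For \<open>card F \<le> k\<close> there are at
  least \<open>2 * (k + 1) - card F\<close> of them: if \<open>k - 1\<close> points suffice to meet all of \<open>F\<close>, complete
  them by an arbitrary point; otherwise \<open>F\<close> consists of \<open>k\<close> disjoint sets and has \<open>k ^ k\<close> systems
  of representatives.
\<close>

section \<open>Transversals of a family of sets\<close>

definition transversals :: "'a set \<Rightarrow> nat \<Rightarrow> 'a set set \<Rightarrow> 'a set set" where
  "transversals X k F = {T. T \<subseteq> X \<and> card T = k \<and> (\<forall>A\<in>F. T \<inter> A \<noteq> {})}"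

lemma finite_transversals: "finite X \<Longrightarrow> finite (transversals X k F)"
  by (rule finite_subset[of _ "Pow X"]) (auto simp: transversals_def)

text \<open>Picking a point of \<open>A\<close> in each \<open>B i\<close> gives an injection from
  \<open>I\<close> into \<open>A\<close>, because the \<open>B i\<close> are disjoint.\<close>

lemma card_disjoint_family_le:
  assumes "finite A" "disjoint_family_on B I" "\<And>i. i \<in> I \<Longrightarrow> A \<inter> B i \<noteq> {}"
  shows "card I \<le> card A"
proof -
  have "\<forall>i\<in>I. \<exists>x. x \<in> A \<inter> B i"
    using assms(3) by blast
  then obtain g where g: "\<And>i. i \<in> I \<Longrightarrow> g i \<in> A \<inter> B i"
    by metis
  have "inj_on g I"
  proof (rule inj_onI, rule ccontr)
    fix i j assume "i \<in> I" "j \<in> I" "g i = g j" "i \<noteq> j"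
    then show False
      using g[of i] g[of j] disjoint_family_onD[OF assms(2), of i j] by auto
  qed
  then show ?thesis
    using g assms(1) by (intro card_inj_on_le[of g]) auto
qed

lemma ex_hitting_set:
  assumes "finite F" "\<And>A. A \<in> F \<Longrightarrow> A \<noteq> {}" "\<And>A. A \<in> F \<Longrightarrow> A \<subseteq> X"
  shows "\<exists>S. S \<subseteq> X \<and> finite S \<and> card S \<le> card F \<and> (\<forall>A\<in>F. S \<inter> A \<noteq> {})"
proof -
  have "\<forall>A\<in>F. \<exists>x. x \<in> A"
    using assms(2) by blast
  then obtain g where g: "\<And>A. A \<in> F \<Longrightarrow> g A \<in> A"
    by metis
  show ?thesis
    using g assms by (intro exI[of _ "g ` F"]) (auto intro: card_image_le)
qed

text \<open>Enlarge \<open>S\<close> to a set \<open>C\<close> of \<open>k - 1\<close> points of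
  \<open>X\<close>. It still meets every member of \<open>F\<close>, and each of the
  \<open>card X - k + 1\<close> points outside \<open>C\<close> completes it to a different
  transversal.\<close>

lemma card_transversals_ge_of_hitting_set:
  assumes X: "finite X" "k \<le> card X" and "k > 0"
    and S: "S \<subseteq> X" "card S < k" "\<forall>A\<in>F. S \<inter> A \<noteq> {}"
  shows "card X - k + 1 \<le> card (transversals X k F)"
proof -
  have "\<exists>C. S \<subseteq> C \<and> C \<subseteq> X \<and> card C = k - 1"
    by (rule exists_subset_between) (use assms in auto)
  then obtain C where C: "S \<subseteq> C" "C \<subseteq> X" "card C = k - 1"
    by blast
  have finC: "finite C"
    using C X finite_subset by blast
  have "card X - k + 1 = card (X - C)"
    using C X \<open>k > 0\<close> finC by (simp add: card_Diff_subset)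
  also have "\<dots> = card ((\<lambda>x. insert x C) ` (X - C))"
    by (rule card_image[symmetric]) (auto intro!: inj_onI)
  also have "\<dots> \<le> card (transversals X k F)"
  proof (rule card_mono[OF finite_transversals[OF X(1)]], rule image_subsetI)
    fix x assume x: "x \<in> X - C"
    have "insert x C \<inter> A \<noteq> {}" if "A \<in> F" for A
      using S(3) C(1) that by blast
    then show "insert x C \<in> transversals X k F"
      using x C finC \<open>k > 0\<close> by (simp add: transversals_def)
  qed
  finally show ?thesis .
qed

text \<open>A choice function \<open>g\<close> on \<open>F\<close> has a transversal as its image.
  By disjointness this image meets each \<open>A\<close> in \<open>g A\<close> alone, so it
  determines \<open>g\<close>, and choice functions are counted by the product.\<close>

lemma card_transversals_ge_of_disjoint:
  assumes X: "finite X" and "finite F" and F: "\<And>A. A \<in> F \<Longrightarrow> A \<subseteq> X" and "disjoint F"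
  shows "(\<Prod>A\<in>F. card A) \<le> card (transversals X (card F) F)"
proof -
  let ?P = "PiE F (\<lambda>A. A)"
  have meet: "g ` F \<inter> A = {g A}" if g: "g \<in> ?P" and A: "A \<in> F" for g A
  proof -
    have "B = A" if "B \<in> F" "g B \<in> A" for B
      using disjointD[OF \<open>disjoint F\<close> that(1) A] PiE_mem[OF g that(1)] that(2) by blast
    then show ?thesis
      using PiE_mem[OF g A] A by blast
  qed
  have inj: "inj_on (\<lambda>g. g ` F) ?P"
  proof (rule inj_onI)
    fix g h assume gh: "g \<in> ?P" "h \<in> ?P" "g ` F = h ` F"
    have "g A = h A" if "A \<in> F" for A
      using meet[OF gh(1) that] meet[OF gh(2) that] gh(3) by simp
    then show "g = h"
      by (rule PiE_ext[OF gh(1,2)])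
  qed
  have sub: "(\<lambda>g. g ` F) ` ?P \<subseteq> transversals X (card F) F"
  proof (rule image_subsetI)
    fix g assume g: "g \<in> ?P"
    have "inj_on g F"
    proof (rule inj_onI, rule ccontr)
      fix A B assume "A \<in> F" "B \<in> F" "g A = g B" "A \<noteq> B"
      then show False
        using PiE_mem[OF g] disjointD[OF \<open>disjoint F\<close>] by (metis disjoint_iff)
    qed
    moreover have "g ` F \<subseteq> X"
      using PiE_mem[OF g] F by blast
    ultimately show "g ` F \<in> transversals X (card F) F"
      using meet[OF g] by (simp add: transversals_def card_image)
  qed
  have "(\<Prod>A\<in>F. card A) = card ((\<lambda>g. g ` F) ` ?P)"
    using \<open>finite F\<close> by (simp add: card_image[OF inj] card_PiE)
  also have "\<dots> \<le> card (transversals X (card F) F)"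
    using sub by (rule card_mono[OF finite_transversals[OF X]])
  finally show ?thesis .
qed

lemma card_transversals_ge:
  assumes X: "finite X" "card X \<ge> k * (k + 1)" and k: "k > 1"
    and F: "finite F" "card F \<le> k" "\<And>A. A \<in> F \<Longrightarrow> A \<subseteq> X \<and> card A = k"
  shows "2 * (k + 1) \<le> card (transversals X k F) + card F"
proof -
  have kk: "2 * k \<le> k * k"
    using k by simp
  have kX: "3 * k \<le> card X"
    using X(2) kk unfolding distrib_left mult_1_right by linarith
  have ne: "A \<noteq> {}" if "A \<in> F" for A
    using F(3)[OF that] k by auto
  \<comment> \<open>The empty family also has a small hitting set, but the bound from hitting sets
    can then fall short by one: \<open>k = 2\<close> and \<open>card X = 6\<close> give 5 instead of
    6.\<close>
  consider "F = {}" | S where "F \<noteq> {}" "S \<subseteq> X" "card S < k" "\<forall>A\<in>F. S \<inter> A \<noteq> {}"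
    | "F \<noteq> {}" "card F = k" "disjoint F"
  proof (cases "card F < k \<or> \<not> disjoint F")
    case False
    then have "card F = k" "disjoint F"
      using F(2) by auto
    moreover from this k have "F \<noteq> {}"
      by auto
    ultimately show ?thesis
      using that(3) by blast
  next
    case True
    have "\<exists>S. S \<subseteq> X \<and> card S < k \<and> (\<forall>A\<in>F. S \<inter> A \<noteq> {})"
    proof (cases "disjoint F")
      case True
      then have "card F < k"
        using \<open>card F < k \<or> \<not> disjoint F\<close> by blast
      moreover have "\<exists>S. S \<subseteq> X \<and> finite S \<and> card S \<le> card F \<and> (\<forall>A\<in>F. S \<inter> A \<noteq> {})"
        by (rule ex_hitting_set) (use F ne in auto)
      ultimately show ?thesis
        by (meson le_less_trans)
    next
      case False
      \<comment> \<open>The common point \<open>x\<close> hits both \<open>A\<close> and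
        \<open>B\<close>, and one point for each of the at most \<open>k - 2\<close> other members
        makes at most \<open>k - 1\<close> points in total.\<close>
      then obtain A B x where AB: "A \<in> F" "B \<in> F" "A \<noteq> B" "x \<in> A" "x \<in> B"
        by (auto simp: disjoint_def)
      have "\<exists>S. S \<subseteq> X \<and> finite S \<and> card S \<le> card (F - {A, B}) \<and> (\<forall>A\<in>F - {A, B}. S \<inter> A \<noteq> {})"
        by (rule ex_hitting_set) (use F ne in auto)
      then obtain S where S: "S \<subseteq> X" "finite S" "card S \<le> card (F - {A, B})"
        "\<forall>A\<in>F - {A, B}. S \<inter> A \<noteq> {}"
        by blast
      have "card (F - {A, B}) = card F - 2"
        using AB F(1) by (simp add: card_Diff_subset)
      then have "card (insert x S) < k"
        using S(2,3) F(2) k by (auto simp: card_insert_if)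
      moreover have "insert x S \<subseteq> X"
        using S(1) AB F(3) by blast
      moreover have "insert x S \<inter> C \<noteq> {}" if "C \<in> F" for C
        using S(4) AB(4,5) that by blast
      ultimately show ?thesis
        by blast
    qed
    then show ?thesis
      using that(1,2) by blast
  qed
  then show ?thesis
  proof cases
    case 1
    \<comment> \<open>Every \<open>k\<close>-subset of \<open>X\<close> is a transversal here. With
      \<open>N = card X\<close>, their number is at least \<open>(N / k) ^ k\<close>, where
      \<open>N / k\<close> is at least \<open>k + 1\<close>.\<close>
    have "real (k + 1) ^ 2 \<le> real (k + 1) ^ k"
      using k by (intro power_increasing) auto
    also have "real (k + 1) \<le> real (card X) / real k"
      using X(2) k by (simp add: field_simps flip: of_nat_mult of_nat_add)
    then have "real (k + 1) ^ k \<le> (real (card X) / real k) ^ k"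
      by (rule power_mono) simp
    also have "\<dots> \<le> real (card X choose k)"
      using binomial_ge_n_over_k_pow_k[of k "card X", where 'a = real] kX by simp
    finally have "(k + 1) ^ 2 \<le> card X choose k"
      by (metis of_nat_le_iff of_nat_power)
    moreover have "card (transversals X k F) = card X choose k"
      using 1 n_subsets[OF X(1)] by (simp add: transversals_def)
    moreover have "2 * (k + 1) \<le> (k + 1) ^ 2"
      using k by (simp add: power2_eq_square)
    ultimately show ?thesis
      by linarith
  next
    case 2
    \<comment> \<open>As \<open>card X\<close> is at least \<open>3 * k\<close>, this yields
      \<open>2 * k + 1\<close> transversals; the missing unit comes from
      \<open>card F > 0\<close>.\<close>
    have "card X - k + 1 \<le> card (transversals X k F)"
      by (rule card_transversals_ge_of_hitting_set[OF X(1) _ _ 2(2-4)]) (use kX k in auto)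
    moreover have "card F > 0"
      using 2 F(1) by (simp add: card_gt_0_iff)
    ultimately show ?thesis
      using kX by arith
  next
    case 3
    \<comment> \<open>The \<open>k ^ k\<close> systems of representatives number at least
      \<open>2 * k\<close>; adding \<open>card F = k\<close> gives \<open>3 * k\<close>, which is at
      least \<open>2 * k + 2\<close> for \<open>k > 1\<close>.\<close>
    have "k ^ k = (\<Prod>A\<in>F. card A)"
      using F(3) 3 by simp
    also have "\<dots> \<le> card (transversals X k F)"
      using card_transversals_ge_of_disjoint[OF X(1) F(1) _ 3(3)] F(3) 3(2) by simp
    finally have "k ^ k \<le> card (transversals X k F)" .
    moreover have "k ^ 2 \<le> k ^ k"
      using k by (intro power_increasing) auto
    ultimately have "2 * k \<le> card (transversals X k F)"
      using kk unfolding power2_eq_square by (meson le_trans)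
    then show ?thesis
      using 3(2) k by simp
  qed
qed

section \<open>Lower bound on the weight\<close>

lemma finite_pverts_kneser_graph: "finite (pverts (kneser_graph n k))"
  by (rule finite_subset[of _ "Pow {1..n}"]) (auto simp: kneser_graph_def)

lemma roman_weight_kneser_graph_ge:
  assumes k: "k > 1" and n: "n \<ge> k * (k + 1)" and f: "roman_dominating (kneser_graph n k) f"
  shows "2 * (k + 1) \<le> roman_weight (kneser_graph n k) f"
proof -
  let ?V = "pverts (kneser_graph n k)"
  define F where "F = {v \<in> ?V. f v = 2}"
  define T where "T = transversals {1..n} k F"
  have finV: "finite ?V"
    by (rule finite_pverts_kneser_graph)
  have FV: "F \<subseteq> ?V" and TV: "T \<subseteq> ?V"
    by (auto simp: F_def T_def transversals_def kneser_graph_def)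
  have finF: "finite F"
    using FV finV finite_subset by blast
  have T_pos: "f v \<noteq> 0" if "v \<in> T" for v
  proof
    assume "f v = 0"
    moreover have "v \<in> ?V"
      using that TV by blast
    ultimately obtain u where "u \<in> F" "(v, u) \<in> parcs (kneser_graph n k)"
      using f by (auto simp: roman_dominating_def F_def)
    then show False
      using that by (auto simp: T_def transversals_def kneser_graph_def)
  qed
  show ?thesis
  proof (cases "card F \<le> k")
    case True
    have "2 * (k + 1) \<le> card T + card F"
      unfolding T_def
      by (rule card_transversals_ge) (use n k finF True FV in \<open>auto simp: kneser_graph_def\<close>)
    \<comment> \<open>\<open>T\<close> and \<open>F\<close> may overlap. A vertex in both is counted
      twice, which its value 2 pays for; a vertex of \<open>T\<close> outside \<open>F\<close> has
      value at least 1.\<close>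
    also have "\<dots> = (\<Sum>v\<in>?V. of_bool (v \<in> T) + of_bool (v \<in> F))"
      using TV FV finV by (simp add: sum.distrib Int_absorb1)
    also have "\<dots> \<le> (\<Sum>v\<in>?V. f v)"
      using T_pos by (intro sum_mono) (auto simp: F_def Suc_le_eq)
    finally show ?thesis
      by (simp add: roman_weight_def)
  next
    case False
    \<comment> \<open>At least \<open>k + 1\<close> vertices of value 2 already carry the required
      weight.\<close>
    then have "2 * (k + 1) \<le> (\<Sum>v\<in>F. f v)"
      by (simp add: F_def)
    also have "\<dots> \<le> (\<Sum>v\<in>?V. f v)"
      using FV finV by (intro sum_mono2) auto
    finally show ?thesis
      by (simp add: roman_weight_def)
  qed
qed

section \<open>Upper bound from disjoint blocks\<close>

lemma roman_domination_number_kneser_graph_le: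
  assumes n: "n \<ge> k * (k + 1)"
  shows "roman_domination_number (kneser_graph n k) \<le> 2 * (k + 1)"
proof -
  let ?G = "kneser_graph n k"
  \<comment> \<open>The \<open>B i\<close> with \<open>i\<close> at most \<open>k\<close> are
    \<open>k + 1\<close> consecutive blocks of length \<open>k\<close>; they fit into
    \<open>{1..n}\<close> because the last one ends at \<open>(k + 1) * k\<close>.\<close>
  define B where "B i = {i * k + 1..i * k + k}" for i :: nat
  define f :: "nat set \<Rightarrow> nat" where "f A = (if A \<in> B ` {..k} then 2 else 0)" for A
  have B_sub: "B i \<subseteq> {1..n}" if "i \<le> k" for i
  proof -
    have "i * k + k \<le> (k + 1) * k"
      using mult_right_mono[of "i + 1" "k + 1" k] that by simp
    also have "\<dots> \<le> n"
      using n by (simp add: mult.commute)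
    finally have "i * k + k \<le> n" .
    then show ?thesis
      by (auto simp: B_def)
  qed
  have B_vert: "B i \<in> pverts ?G" if "i \<le> k" for i
    using B_sub[OF that] by (auto simp: kneser_graph_def B_def)
  have B_less: "B i \<inter> B j = {}" if "i < j" for i j
    using mult_right_mono[of "i + 1" j k] that by (auto simp: B_def)
  have disj: "disjoint_family_on B {..k}"
    unfolding disjoint_family_on_def using B_less by (metis Int_commute nat_neq_iff)
  have "roman_dominating ?G f"
    unfolding roman_dominating_def
  proof (intro conjI ballI impI)
    fix A assume A: "A \<in> pverts ?G"
    show "f A \<in> {0, 1, 2}"
      by (simp add: f_def)
    have "finite A" "card A = k"
      using A finite_subset by (auto simp: kneser_graph_def)
    then have "\<not> (\<forall>i\<in>{..k}. A \<inter> B i \<noteq> {})"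
      using card_disjoint_family_le[OF _ disj, of A] by auto
    then obtain i where i: "i \<le> k" "A \<inter> B i = {}"
      by auto
    moreover from i A B_vert[OF i(1)] have "(A, B i) \<in> parcs ?G"
      by (auto simp: kneser_graph_def)
    ultimately show "\<exists>u\<in>pverts ?G. (A, u) \<in> parcs ?G \<and> f u = 2"
      using B_vert by (intro bexI[of _ "B i"]) (auto simp: f_def)
  qed
  then have "roman_domination_number ?G \<le> roman_weight ?G f"
    by (rule roman_domination_number_le)
  also have "\<dots> = (\<Sum>A\<in>B ` {..k}. 2)"
    unfolding roman_weight_def
    by (rule sum.mono_neutral_cong_right)
      (use B_vert finite_pverts_kneser_graph in \<open>auto simp: f_def\<close>)
  also have "\<dots> \<le> 2 * (k + 1)"
    using card_image_le[of "{..k}" B] by simp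
  finally show ?thesis .
qed

theorem corollary1:
  fixes n k :: nat
  assumes "n > 0" and "k > 1" and "n \<ge> k * (k + 1)"
  shows "roman_domination_number (kneser_graph n k) = 2 * (k + 1)"
proof (rule antisym)
  show "roman_domination_number (kneser_graph n k) \<le> 2 * (k + 1)"
    using assms(3) by (rule roman_domination_number_kneser_graph_le)
  show "2 * (k + 1) \<le> roman_domination_number (kneser_graph n k)"
    using roman_domination_number_attained[of "kneser_graph n k"]
      roman_weight_kneser_graph_ge[OF assms(2,3)] by metis
qed

end
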